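(* Let $p>3$ be a prime and $a$ a rational number whose denominator is not divisible by $p$, with $\big(\frac{a(4-27a)}p\big)=-1$. Then $x\equiv\sum_{k=0}^{[p/3]}\binom{3k}k a^k\pmod p$ is the unique solution of the cubic congruence $(27a-4)x^3+3x+1\equiv0\pmod p$.
   Context: $[x]$ denotes the greatest integer not exceeding $x$. For a rational number $r$ whose denominator is prime to $p$, $\big(\frac rp\big)$ is the Legendre symbol of the residue of $r$ modulo $p$, and congruences mod $p$ are taken in the ring of such rationals. *)

theory Defs
  imports "HOL-Number_Theory.Number_Theory"
begin

definition p_integers :: "nat \<Rightarrow> rat set" where
  "p_integers p = {r. \<not> int p dvd snd (quotient_of r)}"

definition p_cong :: "nat \<Rightarrow> rat \<Rightarrow> rat \<Rightarrow> bool" where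
  "p_cong p x y \<longleftrightarrow>
     x \<in> p_integers p \<and> y \<in> p_integers p \<and> (\<exists>t\<in>p_integers p. x - y = of_nat p * t)"

definition p_residue :: "nat \<Rightarrow> rat \<Rightarrow> int" where
  "p_residue p r = (THE m. 0 \<le> m \<and> m < int p \<and> p_cong p r (of_int m))"

definition rat_Legendre :: "rat \<Rightarrow> nat \<Rightarrow> int" where
  "rat_Legendre r p = Legendre (p_residue p r) (int p)"

lemma p_integers_iff:
  "x \<in> p_integers p \<longleftrightarrow> (\<exists>n d. \<not> int p dvd d \<and> x = of_int n / of_int d)"
proof
  assume "x \<in> p_integers p"
  moreover have "x = of_int (fst (quotient_of x)) / of_int (snd (quotient_of x))"
    by (rule quotient_of_div) simp
  ultimately show "\<exists>n d. \<not> int p dvd d \<and> x = of_int n / of_int d"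
    unfolding p_integers_def by blast
next
  assume "\<exists>n d. \<not> int p dvd d \<and> x = of_int n / of_int d"
  then obtain n d where d: "\<not> int p dvd d" and x: "x = of_int n / of_int d" by blast
  obtain n' d' where q: "quotient_of x = (n', d')" by fastforce
  have d'0: "d' > 0" using quotient_of_denom_pos[OF q] .
  have d0: "d \<noteq> 0" using d by auto
  have "of_int n / of_int d = (of_int n' / of_int d' :: rat)"
    using quotient_of_div[OF q] x by simp
  then have "(of_int (n * d') :: rat) = of_int (n' * d)"
    using d0 d'0 by (simp add: field_simps)
  then have "n * d' = n' * d" by (simp only: of_int_eq_iff)
  then have "d' dvd n' * d" by (metis dvd_triv_right)
  moreover have "coprime d' n'"
    using quotient_of_coprime[OF q] by (simp add: coprime_commute)
  ultimately have "d' dvd d" by (simp add: coprime_dvd_mult_right_iff)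
  then show "x \<in> p_integers p" using d q dvd_trans unfolding p_integers_def by fastforce
qed

lemma p_residue_well_defined:
  assumes p: "prime p" and r: "r \<in> p_integers p"
  shows "\<exists>!m. 0 \<le> m \<and> m < int p \<and> p_cong p r (of_int m)"
proof -
  have pp: "prime (int p)" using p by simp
  obtain n d where d: "\<not> int p dvd d" and rnd: "r = of_int n / of_int d"
    using r p_integers_iff by blast
  have d0: "d \<noteq> 0" using d by auto
  have int_in: "of_int k \<in> p_integers p" for k
    unfolding p_integers_iff using prime_gt_1_nat[OF p]
    by (intro exI[of _ k] exI[of _ 1]) auto
  have key: "p_cong p r (of_int m) \<longleftrightarrow> [d * m = n] (mod int p)" for m
  proof
    assume "p_cong p r (of_int m)"
    then obtain t where t: "t \<in> p_integers p" "r - of_int m = of_nat p * t"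
      unfolding p_cong_def by blast
    then obtain k e where e: "\<not> int p dvd e" "t = of_int k / of_int e"
      using p_integers_iff by blast
    have e0: "e \<noteq> 0" using e by auto
    have "(of_int n / of_int d - of_int m :: rat) = of_nat p * (of_int k / of_int e)"
      using t e rnd by simp
    then have "(of_int ((n - d * m) * e) :: rat) = of_int (int p * k * d)"
      using d0 e0 by (simp add: field_simps)
    then have "(n - d * m) * e = int p * k * d" by (simp only: of_int_eq_iff)
    then have "int p dvd (n - d * m) * e" by simp
    then have "int p dvd n - d * m" using e(1) pp prime_dvd_multD by blast
    then show "[d * m = n] (mod int p)" by (metis cong_iff_dvd_diff cong_sym)
  next
    assume "[d * m = n] (mod int p)"
    then have "int p dvd n - d * m" by (metis cong_iff_dvd_diff cong_sym)
    then obtain k where k: "n - d * m = int p * k" by blast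
    have "(of_int (n - d * m) :: rat) = of_int (int p * k)" using k by simp
    then have "r - of_int m = of_nat p * (of_int k / of_int d)"
      using d0 rnd by (simp add: field_simps)
    moreover have "of_int k / of_int d \<in> p_integers p" using d p_integers_iff by blast
    ultimately show "p_cong p r (of_int m)" unfolding p_cong_def using r int_in by blast
  qed
  have cop: "coprime d (int p)" using d pp by (metis coprime_commute prime_imp_coprime)
  then obtain u where u: "[d * u = 1] (mod int p)" using cong_solve_coprime_int by blast
  have p0: "int p > 0" using p prime_gt_0_nat by simp
  show ?thesis unfolding key
  proof (rule ex1I[of _ "(u * n) mod int p"])
    have "[d * ((u * n) mod int p) = d * u * n] (mod int p)"
      by (simp add: cong_def mod_mult_right_eq mult.assoc)
    also have "[d * u * n = 1 * n] (mod int p)" using u by (rule cong_scalar_right)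
    finally show "0 \<le> (u * n) mod int p \<and> (u * n) mod int p < int p \<and>
        [d * ((u * n) mod int p) = n] (mod int p)" using p0 by simp
    fix m assume m: "0 \<le> m \<and> m < int p \<and> [d * m = n] (mod int p)"
    then have "[d * m = d * ((u * n) mod int p)] (mod int p)"
      using \<open>0 \<le> (u * n) mod int p \<and> _\<close> cong_trans cong_sym by blast
    then have "[m = (u * n) mod int p] (mod int p)" using cop cong_mult_lcancel by blast
    then show "m = (u * n) mod int p" using m p0 by (simp add: cong_def)
  qed
qed

end

theory Submission
  imports Defs
begin

text \<open>
  Put \<open>n = p div 3\<close> and \<open>t = -27a\<close>. Modulo \<open>p\<close> the number \<open>3n\<close> is \<open>-1\<close> or \<open>-2\<close>, so
  \<open>binomial(3k, k) \<equiv> (-27)^k binomial(n + k, 2k)\<close> and the sum is congruent to the Morgan-Voyce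
  polynomial \<open>b\<^sub>n(t)\<close>. If \<open>u + 1/u = t + 2\<close> then \<open>b\<^sub>n(t) = (u^(n+1) + u^(-n)) / (u + 1)\<close>, whence the
  formula \<open>b\<^sub>3\<^sub>n\<^sub>+\<^sub>1 = (t + 4) b\<^sub>n\<^sup>3 - 3 b\<^sub>n\<close>; so \<open>b\<^sub>n(t)\<close> is a root of the cubic as soon as
  \<open>b\<^sub>3\<^sub>n\<^sub>+\<^sub>1(t) \<equiv> 1\<close>. Here \<open>3n + 1\<close> is \<open>p\<close> or \<open>p - 1\<close>, and the Frobenius map sends \<open>u\<close> to \<open>1/u\<close> or
  fixes it, according to the quadratic character of \<open>t (t + 4) = -27a (4 - 27a)\<close>. By
  quadratic reciprocity these two alternatives match.
  A second root is impossible, since the discriminant \<open>27\<^sup>2 a (4 - 27a)\<close> of the cubic would then be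
  a square modulo \<open>p\<close>.
\<close>

section \<open>Legendre symbols\<close>

lemma Legendre_cong: "[a = b] (mod p) \<Longrightarrow> Legendre a p = Legendre b p"
  unfolding Legendre_def QuadRes_def by (simp add: cong_def)

lemma Legendre_eqI:
  fixes p :: nat
  assumes "prime p" "2 < p" "[a ^ ((p - 1) div 2) = e] (mod int p)" "e \<in> {-1, 0, 1}"
  shows "Legendre a (int p) = e"
proof -
  have "[Legendre a (int p) = e] (mod int p)"
    using euler_criterion[OF assms(1,2)] assms(3) by (rule cong_trans)
  then have "int p dvd Legendre a (int p) - e"
    by (simp add: cong_iff_dvd_diff)
  moreover have "\<bar>Legendre a (int p) - e\<bar> < int p"
    using assms(2,4) by (auto simp: Legendre_def)
  ultimately show ?thesis
    using dvd_imp_le_int[of "Legendre a (int p) - e" "int p"] by auto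
qed

lemma Legendre_mult:
  fixes p :: nat
  assumes "prime p" "2 < p"
  shows "Legendre (a * b) (int p) = Legendre a (int p) * Legendre b (int p)"
proof (rule Legendre_eqI[OF assms])
  show "[(a * b) ^ ((p - 1) div 2) = Legendre a (int p) * Legendre b (int p)] (mod int p)"
    unfolding power_mult_distrib
    by (intro cong_mult cong_sym[OF euler_criterion] assms)
qed (auto simp: Legendre_def)

lemma Legendre_square:
  assumes "prime p" "\<not> p dvd a"
  shows "Legendre (a\<^sup>2) p = 1"
proof -
  have "\<not> [a\<^sup>2 = 0] (mod p)"
    using assms by (simp add: cong_0_iff prime_dvd_power_iff)
  moreover have "QuadRes p (a\<^sup>2)"
    unfolding QuadRes_def by (intro exI[of _ a] cong_refl)
  ultimately show ?thesis
    by (simp add: Legendre_def)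
qed

lemma Legendre_minus_one:
  fixes p :: nat
  assumes "prime p" "2 < p"
  shows "Legendre (-1) (int p) = (-1) ^ ((p - 1) div 2)"
  by (rule Legendre_eqI[OF assms cong_refl]) (simp add: minus_one_power_iff)

lemma Legendre_mod_three:
  "Legendre a 3 = (if a mod 3 = 0 then 0 else if a mod 3 = 1 then 1 else -1)"
proof -
  have "Legendre a (int 3) = (if a mod 3 = 0 then 0 else if a mod 3 = 1 then 1 else -1)"
  proof (rule Legendre_eqI)
    show "[a ^ ((3 - 1) div 2) = (if a mod 3 = 0 then 0 else if a mod 3 = 1 then 1 else -1)]
        (mod int 3)"
      unfolding cong_def by simp presburger
  qed auto
  then show ?thesis by simp
qed

lemma prime_mod_three:
  fixes p :: nat
  assumes "prime p" "3 < p"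
  shows "p mod 3 = 1 \<or> p mod 3 = 2"
proof -
  have "\<not> 3 dvd p"
    using assms primes_dvd_imp_eq[of 3 p] by auto
  then show ?thesis by presburger
qed

lemma Legendre_minus_three:
  fixes p :: nat
  assumes "prime p" "3 < p"
  shows "Legendre (-3) (int p) = (if p mod 3 = 1 then 1 else -1)"
proof -
  have mod_three: "Legendre (int p) 3 = (if p mod 3 = 1 then 1 else -1)"
    using prime_mod_three[OF assms] zmod_int[of p 3] by (auto simp: Legendre_mod_three)
  have "Legendre (int p) (int 3) * Legendre (int 3) (int p) =
      (-1) ^ ((p - 1) div 2 * ((3 - 1) div 2))"
    by (rule Quadratic_Reciprocity) (use assms in auto)
  then have reciprocity: "Legendre (int p) 3 * Legendre 3 (int p) = (-1) ^ ((p - 1) div 2)"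
    by simp
  have "Legendre (-3) (int p) = Legendre (-1) (int p) * Legendre 3 (int p)"
    using Legendre_mult[of p "-1" 3] assms by simp
  also have "\<dots> = Legendre (int p) 3 * (Legendre 3 (int p) * Legendre 3 (int p))"
    using assms by (simp only: Legendre_minus_one flip: reciprocity)
  also have "Legendre 3 (int p) * Legendre 3 (int p) = 1"
    using reciprocity by (auto simp: Legendre_def split: if_splits)
  finally show ?thesis
    using mod_three by simp
qed

section \<open>Two incongruent roots of a cubic\<close>

definition cubic_discriminant :: "'a :: comm_ring_1 \<Rightarrow> 'a \<Rightarrow> 'a \<Rightarrow> 'a \<Rightarrow> 'a" where
  "cubic_discriminant a b c d =
     b\<^sup>2 * c\<^sup>2 - 4 * a * c ^ 3 - 4 * b ^ 3 * d - 27 * a\<^sup>2 * d\<^sup>2 + 18 * a * b * c * d"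

text \<open>
  Modulo \<open>f(z)\<close> the discriminant of \<open>f\<close> is the discriminant of the quadratic cofactor of \<open>X - z\<close>
  times the square of \<open>f'(z)\<close>, and \<open>x\<close> is a root of that cofactor.
\<close>

lemma QuadRes_cubic_discriminant:
  fixes a b c d x z p :: int
  assumes "prime p"
    and x: "[a * x ^ 3 + b * x\<^sup>2 + c * x + d = 0] (mod p)"
    and z: "[a * z ^ 3 + b * z\<^sup>2 + c * z + d = 0] (mod p)"
    and "\<not> [x = z] (mod p)"
  shows "QuadRes p (cubic_discriminant a b c d)"
proof -
  define fz where "fz = a * z ^ 3 + b * z\<^sup>2 + c * z + d"
  define f'z where "f'z = 3 * a * z\<^sup>2 + 2 * b * z + c"
  define B where "B = a * z + b"
  define C where "C = a * z\<^sup>2 + b * z + c"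
  note defs = fz_def f'z_def B_def C_def
  have "p dvd (a * x ^ 3 + b * x\<^sup>2 + c * x + d) - fz"
    using x z unfolding fz_def cong_0_iff by (rule dvd_diff)
  also have "\<dots> = (x - z) * (a * x\<^sup>2 + B * x + C)"
    unfolding defs by Groebner_Basis.algebra
  finally have cofactor: "p dvd a * x\<^sup>2 + B * x + C"
    using assms prime_dvd_multD cong_iff_dvd_diff by blast
  have "((2 * a * x + B) * f'z)\<^sup>2 - cubic_discriminant a b c d =
      (a * x\<^sup>2 + B * x + C) * (4 * a * f'z\<^sup>2) -
      fz * (18 * a * b * c - 4 * b ^ 3 - 27 * a\<^sup>2 * (2 * d - fz))"
    unfolding cubic_discriminant_def defs by Groebner_Basis.algebra
  moreover have "p dvd \<dots>"
    using cofactor z by (intro dvd_diff dvd_mult2) (simp_all add: fz_def cong_0_iff)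
  ultimately have "[((2 * a * x + B) * f'z)\<^sup>2 = cubic_discriminant a b c d] (mod p)"
    by (simp add: cong_iff_dvd_diff)
  then show ?thesis
    unfolding QuadRes_def by blast
qed

lemma cubic_root_unique:
  fixes p :: nat and a x z :: int
  assumes p: "prime p" "3 < p" and nonresidue: "Legendre (a * (4 - 27 * a)) (int p) = -1"
    and x: "[(27 * a - 4) * x ^ 3 + 3 * x + 1 = 0] (mod int p)"
    and z: "[(27 * a - 4) * z ^ 3 + 3 * z + 1 = 0] (mod int p)"
  shows "[x = z] (mod int p)"
proof (rule ccontr)
  assume "\<not> [x = z] (mod int p)"
  then have "QuadRes (int p) (cubic_discriminant (27 * a - 4) 0 3 1)"
    using p x z by (intro QuadRes_cubic_discriminant[where x = x and z = z]) auto
  moreover have "cubic_discriminant (27 * a - 4) 0 3 1 = 27\<^sup>2 * (a * (4 - 27 * a))"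
    by (simp add: cubic_discriminant_def power2_eq_square power3_eq_cube algebra_simps)
  ultimately have "Legendre (27\<^sup>2 * (a * (4 - 27 * a))) (int p) \<noteq> -1"
    by (simp add: Legendre_def)
  moreover have "\<not> int p dvd 3"
    using p by (auto dest: zdvd_imp_le)
  then have "\<not> int p dvd 3 ^ 3"
    using p prime_dvd_power[of "int p" 3 3] by auto
  then have "Legendre (27\<^sup>2) (int p) = 1"
    using p Legendre_square[of "int p" "3 ^ 3"] by simp
  ultimately show False
    using p nonresidue by (simp add: Legendre_mult)
qed

section \<open>Binomial transforms modulo a prime\<close>

definition binomial_transform :: "'a :: comm_semiring_1 \<Rightarrow> (nat \<Rightarrow> 'a) \<Rightarrow> nat \<Rightarrow> 'a" where
  "binomial_transform y f m = (\<Sum>k\<le>m. of_nat (m choose k) * y ^ (m - k) * f k)"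

lemma binomial_transform_0 [simp]: "binomial_transform y f 0 = f 0"
  by (simp add: binomial_transform_def)

lemma binomial_transform_cmult:
  "binomial_transform y (\<lambda>k. c * f k) m = c * binomial_transform y f m"
  by (simp add: binomial_transform_def sum_distrib_left mult_ac)

lemma binomial_transform_Suc:
  "binomial_transform y f (Suc m) =
    y * binomial_transform y f m + binomial_transform y (\<lambda>k. f (Suc k)) m"
proof -
  have "binomial_transform y f (Suc m) =
    y ^ Suc m * f 0 + (\<Sum>k\<le>m. of_nat (m choose Suc k) * y ^ (m - k) * f (Suc k)) +
    binomial_transform y (\<lambda>k. f (Suc k)) m"
    unfolding binomial_transform_def
    by (subst sum.atMost_Suc_shift) (simp add: algebra_simps sum.distrib)
  also have "y ^ Suc m * f 0 + (\<Sum>k\<le>m. of_nat (m choose Suc k) * y ^ (m - k) * f (Suc k)) =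
    (\<Sum>k\<le>Suc m. of_nat (m choose k) * y ^ (Suc m - k) * f k)"
    by (subst sum.atMost_Suc_shift) simp
  also have "\<dots> = (\<Sum>k\<le>m. of_nat (m choose k) * y ^ (Suc m - k) * f k)"
    by (simp add: binomial_eq_0)
  also have "\<dots> = y * binomial_transform y f m"
    unfolding binomial_transform_def sum_distrib_left
    by (rule sum.cong) (auto simp: Suc_diff_le algebra_simps)
  finally show ?thesis .
qed

lemma power_prime_cong:
  fixes y :: int
  assumes "prime p"
  shows "[y ^ p = y] (mod int p)"
proof (cases "int p dvd y")
  case True
  moreover have "int p dvd y ^ p"
    using True prime_gt_0_nat[OF assms] by (meson dvd_power dvd_trans)
  ultimately show ?thesis
    by (simp add: cong_iff_dvd_diff)
next
  case False
  interpret residues_prime p "residue_ring (int p)"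
    by unfold_locales (use assms in auto)
  have "coprime y (int p)"
    using False assms by (simp add: prime_imp_coprime coprime_commute[of y])
  then have "[y ^ (p - 1) * y = 1 * y] (mod int p)"
    using euler_theorem by (intro cong_scalar_right) (simp add: prime_totient_eq)
  then show ?thesis
    using prime_gt_0_nat[OF assms] by (simp flip: power_Suc2)
qed

lemma binomial_transform_prime_cong:
  fixes y :: int
  assumes "prime p"
  shows "[binomial_transform y f p = y * f 0 + f p] (mod int p)"
proof -
  obtain q where q: "p = Suc q"
    using prime_gt_0_nat[OF assms] gr0_implies_Suc by blast
  have "binomial_transform y f p =
    (\<Sum>k\<in>{1..q}. of_nat (p choose k) * y ^ (p - k) * f k) + (y ^ p * f 0 + f p)"
    unfolding binomial_transform_def q by (simp add: atMost_atLeast0 sum.atLeast_Suc_atMost)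
  also have "[\<dots> = (\<Sum>k\<in>{1..q}. 0) + (y * f 0 + f p)] (mod int p)"
  proof (intro cong_add cong_sum cong_scalar_right power_prime_cong assms cong_refl)
    fix k
    assume "k \<in> {1..q}"
    then have "p dvd (p choose k)"
      using assms q by (intro dvd_choose_prime) auto
    then show "[of_nat (p choose k) * y ^ (p - k) * f k = 0] (mod int p)"
      by (simp add: cong_0_iff)
  qed
  finally show ?thesis
    by simp
qed

lemma cong_double_cancel:
  fixes m x y :: int
  assumes "[2 * x = 2 * y] (mod m)" "odd m"
  shows "[x = y] (mod m)"
  using assms by (simp add: cong_mult_lcancel)

lemma halved_binomial_transform_prime_cong:
  fixes x y :: int
  assumes "prime p" "odd p" "2 ^ p * x = 2 * binomial_transform y f p"
  shows "[x = y * f 0 + f p] (mod int p)"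
proof (rule cong_double_cancel)
  have "[2 * x = 2 ^ p * x] (mod int p)"
    by (intro cong_scalar_right cong_sym[OF power_prime_cong[OF assms(1)]])
  also have "2 ^ p * x = 2 * binomial_transform y f p"
    by (rule assms(3))
  also have "[\<dots> = 2 * (y * f 0 + f p)] (mod int p)"
    by (intro cong_scalar_left binomial_transform_prime_cong assms(1))
  finally show "[2 * x = 2 * (y * f 0 + f p)] (mod int p)" .
qed (use assms(2) in simp)

section \<open>Morgan-Voyce polynomials\<close>

text \<open>
  The second family is shifted: \<open>morgan_voyce_B t n\<close> is usually written \<open>B\<^sub>n\<^sub>-\<^sub>1(t)\<close>. In
  terms of the unit \<open>u = 1 + t + w\<close> with \<open>w\<^sup>2 = t - t w\<close>, the recursion says that
  \<open>u ^ n = morgan_voyce_b t n + morgan_voyce_B t n * w\<close>.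
\<close>

fun morgan_voyce_b morgan_voyce_B :: "'a :: comm_semiring_1 \<Rightarrow> nat \<Rightarrow> 'a" where
  "morgan_voyce_b t 0 = 1"
| "morgan_voyce_b t (Suc n) = (1 + t) * morgan_voyce_b t n + t * morgan_voyce_B t n"
| "morgan_voyce_B t 0 = 0"
| "morgan_voyce_B t (Suc n) = morgan_voyce_b t n + morgan_voyce_B t n"

lemma morgan_voyce_b_Suc':
  "morgan_voyce_b t (Suc n) = morgan_voyce_b t n + t * morgan_voyce_B t (Suc n)"
  by (simp add: algebra_simps)

lemma sum_choose_odd_Suc:
  fixes t :: "'a :: comm_semiring_1"
  shows "(\<Sum>k\<le>Suc n. of_nat ((Suc n + k) choose (2 * k + 1)) * t ^ k) =
    (\<Sum>k\<le>n. of_nat ((n + k) choose (2 * k)) * t ^ k) +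
    (\<Sum>k\<le>n. of_nat ((n + k) choose (2 * k + 1)) * t ^ k)"
proof -
  have "(\<Sum>k\<le>Suc n. of_nat ((Suc n + k) choose (2 * k + 1)) * t ^ k) =
      (\<Sum>k\<le>n. of_nat ((Suc n + k) choose (2 * k + 1)) * t ^ k)"
    by (simp add: binomial_eq_0 del: binomial_Suc_Suc)
  then show ?thesis
    by (simp add: sum.distrib algebra_simps)
qed

lemma sum_choose_even_Suc:
  fixes t :: "'a :: comm_semiring_1"
  shows "(\<Sum>k\<le>Suc n. of_nat ((Suc n + k) choose (2 * k)) * t ^ k) =
    (\<Sum>k\<le>n. of_nat ((n + k) choose (2 * k)) * t ^ k) +
    t * (\<Sum>k\<le>Suc n. of_nat ((Suc n + k) choose (2 * k + 1)) * t ^ k)"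
proof -
  have pascal: "(Suc n + Suc k) choose (2 * Suc k) =
      ((n + Suc k) choose (2 * Suc k)) + ((Suc n + k) choose (2 * k + 1))" for k
    by simp
  have "(\<Sum>k\<le>Suc n. of_nat ((Suc n + k) choose (2 * k)) * t ^ k) =
      1 + (\<Sum>k\<le>n. of_nat ((Suc n + Suc k) choose (2 * Suc k)) * t ^ Suc k)"
    by (subst sum.atMost_Suc_shift) simp
  also have "\<dots> = (1 + (\<Sum>k\<le>n. of_nat ((n + Suc k) choose (2 * Suc k)) * t ^ Suc k)) +
      t * (\<Sum>k\<le>n. of_nat ((Suc n + k) choose (2 * k + 1)) * t ^ k)"
    unfolding pascal by (simp add: sum.distrib sum_distrib_left algebra_simps del: binomial_Suc_Suc)
  also have "1 + (\<Sum>k\<le>n. of_nat ((n + Suc k) choose (2 * Suc k)) * t ^ Suc k) =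
      (\<Sum>k\<le>Suc n. of_nat ((n + k) choose (2 * k)) * t ^ k)"
    by (subst sum.atMost_Suc_shift) simp
  finally show ?thesis
    by (simp add: binomial_eq_0 del: binomial_Suc_Suc)
qed

lemma morgan_voyce_b_sum:
    "morgan_voyce_b t n = (\<Sum>k\<le>n. of_nat ((n + k) choose (2 * k)) * t ^ k)"
  and morgan_voyce_B_sum:
    "morgan_voyce_B t n = (\<Sum>k\<le>n. of_nat ((n + k) choose (2 * k + 1)) * t ^ k)"
proof (induction n)
  case (Suc n)
  show B: "morgan_voyce_B t (Suc n) =
      (\<Sum>k\<le>Suc n. of_nat ((Suc n + k) choose (2 * k + 1)) * t ^ k)"
    unfolding sum_choose_odd_Suc morgan_voyce_B.simps Suc ..
  show "morgan_voyce_b t (Suc n) = (\<Sum>k\<le>Suc n. of_nat ((Suc n + k) choose (2 * k)) * t ^ k)"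
    unfolding sum_choose_even_Suc morgan_voyce_b_Suc' B Suc ..
qed simp_all

lemma morgan_voyce_b_add:
    "morgan_voyce_b t (m + n) =
      morgan_voyce_b t m * morgan_voyce_b t n + t * (morgan_voyce_B t m * morgan_voyce_B t n)"
  and morgan_voyce_B_add:
    "morgan_voyce_B t (m + n) =
      morgan_voyce_b t m * morgan_voyce_B t n + morgan_voyce_B t m * morgan_voyce_b t n -
      t * (morgan_voyce_B t m * morgan_voyce_B t n)"
  for t :: "'a :: comm_ring_1"
proof (induction m)
  case (Suc m)
  show "morgan_voyce_b t (Suc m + n) = morgan_voyce_b t (Suc m) * morgan_voyce_b t n +
      t * (morgan_voyce_B t (Suc m) * morgan_voyce_B t n)"
    and "morgan_voyce_B t (Suc m + n) = morgan_voyce_b t (Suc m) * morgan_voyce_B t n +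
      morgan_voyce_B t (Suc m) * morgan_voyce_b t n -
      t * (morgan_voyce_B t (Suc m) * morgan_voyce_B t n)"
    unfolding add_Suc morgan_voyce_b.simps morgan_voyce_B.simps Suc by (simp_all add: algebra_simps)
qed simp_all

lemma morgan_voyce_norm:
  fixes t :: "'a :: comm_ring_1"
  shows "(morgan_voyce_b t n)\<^sup>2 - t * (morgan_voyce_b t n * morgan_voyce_B t n) -
    t * (morgan_voyce_B t n)\<^sup>2 = 1" (is "?norm n = 1")
proof (induction n)
  case (Suc n)
  have "?norm (Suc n) = ?norm n"
    by (simp add: power2_eq_square algebra_simps)
  with Suc show ?case by simp
qed simp

lemma morgan_voyce_b_triple:
  fixes t :: "'a :: comm_ring_1"
  shows "morgan_voyce_b t (3 * n + 1) = (t + 4) * morgan_voyce_b t n ^ 3 - 3 * morgan_voyce_b t n"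
proof -
  define b where "b = morgan_voyce_b t n"
  define B where "B = morgan_voyce_B t n"
  have "3 * n + 1 = Suc (n + (n + n))" by simp
  then have "morgan_voyce_b t (3 * n + 1) = (t + 4) * b ^ 3 - 3 * b * (b\<^sup>2 - t * (b * B) - t * B\<^sup>2)"
    by (simp only: morgan_voyce_b.simps morgan_voyce_b_add morgan_voyce_B_add flip: b_def B_def)
      (simp add: power2_eq_square power3_eq_cube algebra_simps)
  then show ?thesis
    unfolding b_def B_def morgan_voyce_norm by simp
qed

definition sqrt_power_re :: "'a :: comm_semiring_1 \<Rightarrow> nat \<Rightarrow> 'a" where
  "sqrt_power_re D k = (if even k then D ^ (k div 2) else 0)"

definition sqrt_power_im :: "'a :: comm_semiring_1 \<Rightarrow> nat \<Rightarrow> 'a" where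
  "sqrt_power_im D k = (if odd k then D ^ (k div 2) else 0)"

lemma sqrt_power_re_Suc: "sqrt_power_re D (Suc k) = D * sqrt_power_im D k"
  by (auto simp: sqrt_power_re_def sqrt_power_im_def elim!: oddE)

lemma sqrt_power_im_Suc: "sqrt_power_im D (Suc k) = sqrt_power_re D k"
  by (auto simp: sqrt_power_re_def sqrt_power_im_def)

text \<open>
  With \<open>u\<close> and \<open>w\<close> as above and \<open>D = t (t + 4)\<close> one has \<open>2u = t + 2 + \<surd>D\<close> and \<open>2w = -t + \<surd>D\<close>;
  the two identities compare the coordinates of \<open>2 (2u) ^ m\<close> and \<open>2 (t + 2 + \<surd>D) ^ m\<close>.
\<close>

lemma morgan_voyce_b_binomial_transform:
    "2 ^ m * (2 * morgan_voyce_b t m - t * morgan_voyce_B t m) =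
      2 * binomial_transform (t + 2) (sqrt_power_re (t * (t + 4))) m"
  and morgan_voyce_B_binomial_transform:
    "2 ^ m * morgan_voyce_B t m =
      2 * binomial_transform (t + 2) (sqrt_power_im (t * (t + 4))) m"
  for t :: "'a :: comm_ring_1"
proof (induction m)
  case (Suc m)
  define D where "D = t * (t + 4)"
  define R where "R = binomial_transform (t + 2) (sqrt_power_re D)"
  define I where "I = binomial_transform (t + 2) (sqrt_power_im D)"
  have coordinates: "2 * R m = 2 ^ m * (2 * morgan_voyce_b t m - t * morgan_voyce_B t m)"
    "2 * I m = 2 ^ m * morgan_voyce_B t m"
    using Suc by (simp_all add: R_def I_def D_def)
  have "2 * R (Suc m) = (t + 2) * (2 * R m) + D * (2 * I m)"
    unfolding R_def I_def binomial_transform_Suc sqrt_power_re_Suc binomial_transform_cmult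
    by (simp add: algebra_simps)
  also have "\<dots> = 2 ^ Suc m * (2 * morgan_voyce_b t (Suc m) - t * morgan_voyce_B t (Suc m))"
    unfolding coordinates D_def by (simp add: algebra_simps)
  finally show "2 ^ Suc m * (2 * morgan_voyce_b t (Suc m) - t * morgan_voyce_B t (Suc m)) =
      2 * binomial_transform (t + 2) (sqrt_power_re (t * (t + 4))) (Suc m)"
    unfolding R_def D_def by (rule sym)
  have "2 * I (Suc m) = (t + 2) * (2 * I m) + 2 * R m"
    unfolding R_def I_def binomial_transform_Suc sqrt_power_im_Suc
    by (simp add: algebra_simps)
  also have "\<dots> = 2 ^ Suc m * morgan_voyce_B t (Suc m)"
    unfolding coordinates by (simp add: algebra_simps)
  finally show "2 ^ Suc m * morgan_voyce_B t (Suc m) =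
      2 * binomial_transform (t + 2) (sqrt_power_im (t * (t + 4))) (Suc m)"
    unfolding I_def D_def by (rule sym)
qed (simp_all add: sqrt_power_re_def sqrt_power_im_def)

lemma morgan_voyce_B_prime_cong:
  fixes t :: int
  assumes "prime p" "2 < p"
  shows "[morgan_voyce_B t p = Legendre (t * (t + 4)) (int p)] (mod int p)"
proof -
  have "odd p"
    using assms prime_odd_nat by blast
  then have "[morgan_voyce_B t p = (t * (t + 4)) ^ (p div 2)] (mod int p)"
    using halved_binomial_transform_prime_cong[OF assms(1) _ morgan_voyce_B_binomial_transform]
    by (simp add: sqrt_power_im_def)
  also have "p div 2 = (p - 1) div 2"
    using \<open>odd p\<close> by presburger
  also have "[(t * (t + 4)) ^ ((p - 1) div 2) = Legendre (t * (t + 4)) (int p)] (mod int p)"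
    by (rule cong_sym[OF euler_criterion[OF assms]])
  finally show ?thesis .
qed

lemma morgan_voyce_b_prime_cong:
  fixes t :: int
  assumes "prime p" "2 < p"
  shows "[2 * morgan_voyce_b t p = t + 2 + t * Legendre (t * (t + 4)) (int p)] (mod int p)"
proof -
  have "[2 * morgan_voyce_b t p - t * morgan_voyce_B t p = t + 2] (mod int p)"
    using halved_binomial_transform_prime_cong[OF assms(1) _ morgan_voyce_b_binomial_transform]
      prime_odd_nat[OF assms] by (simp add: sqrt_power_re_def)
  from cong_add[OF this cong_scalar_left[OF morgan_voyce_B_prime_cong[OF assms, of t], of t]]
  show ?thesis
    by simp
qed

lemma morgan_voyce_b_prime_cong_1:
  fixes t :: int
  assumes "prime p" "2 < p" "Legendre (t * (t + 4)) (int p) = -1"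
  shows "[morgan_voyce_b t p = 1] (mod int p)"
proof -
  have "[2 * morgan_voyce_b t p = 2 * 1] (mod int p)"
    using morgan_voyce_b_prime_cong[OF assms(1,2), of t] assms(3) by simp
  then show ?thesis
    by (rule cong_double_cancel) (use assms prime_odd_nat in auto)
qed

lemma morgan_voyce_b_pred_prime_cong_1:
  fixes t :: int
  assumes "prime p" "2 < p" "Legendre (t * (t + 4)) (int p) = 1"
  shows "[morgan_voyce_b t (p - 1) = 1] (mod int p)"
proof -
  have "Suc (p - 1) = p"
    using assms(2) by simp
  then have "morgan_voyce_b t p = morgan_voyce_b t (p - 1) + t * morgan_voyce_B t p"
    by (metis morgan_voyce_b_Suc')
  then have "2 * morgan_voyce_b t (p - 1) = 2 * morgan_voyce_b t p - 2 * t * morgan_voyce_B t p"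
    by simp
  also have "[\<dots> = (t + 2 + t * 1) - 2 * t * 1] (mod int p)"
    using morgan_voyce_b_prime_cong[OF assms(1,2), of t]
      morgan_voyce_B_prime_cong[OF assms(1,2), of t] assms(3)
    by (intro cong_diff cong_scalar_left) simp_all
  also have "(t + 2 + t * 1) - 2 * t * 1 = 2 * 1"
    by simp
  finally show ?thesis
    by (rule cong_double_cancel) (use assms prime_odd_nat in auto)
qed

section \<open>The sum as a Morgan-Voyce polynomial\<close>

lemma fact_mult_choose_triple:
  "fact (2 * k) * ((3 * k) choose k) = (\<Prod>i<k. 3 * (3 * i + 1) * (3 * i + 2))"
proof -
  have "fact (3 * k) = fact k * (\<Prod>i<k. 3 * (3 * i + 1) * (3 * i + 2))" for k :: nat
  proof (induction k)
    case (Suc k)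
    have "fact (3 * Suc k) = (3 * k + 3) * ((3 * k + 2) * ((3 * k + 1) * fact (3 * k)) :: nat)"
      by (simp add: numeral_3_eq_3 algebra_simps)
    then show ?case
      unfolding Suc by (simp add: algebra_simps)
  qed simp
  then have "fact k * (fact (2 * k) * ((3 * k) choose k)) =
      fact k * (\<Prod>i<k. 3 * (3 * i + 1) * (3 * i + 2))"
    using binomial_fact_lemma[of k "3 * k"] by (simp add: mult.assoc)
  then show ?thesis by simp
qed

lemma fact_mult_choose_add:
  assumes "k \<le> n"
  shows "fact (2 * k) * ((n + k) choose (2 * k)) = (\<Prod>i<k. (n + 1 + i) * (n - i))"
proof -
  have "fact (n + k) = fact (n - k) * (\<Prod>i<k. (n + 1 + i) * (n - i))"
    using assms
  proof (induction k)
    case (Suc k)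
    then have "fact (n - k) = (n - k) * (fact (n - Suc k) :: nat)"
      by (metis Suc_diff_Suc Suc_le_lessD fact_Suc of_nat_id)
    moreover have "fact (n + Suc k) = (n + 1 + k) * (fact (n + k) :: nat)"
      by simp
    ultimately show ?case
      using Suc by (simp only: prod.lessThan_Suc mult_ac)
  qed simp
  moreover have "fact (2 * k) * fact (n - k) * ((n + k) choose (2 * k)) = fact (n + k)"
    using binomial_fact_lemma[of "2 * k" "n + k"] assms by simp
  ultimately have "fact (n - k) * (fact (2 * k) * ((n + k) choose (2 * k))) =
      fact (n - k) * (\<Prod>i<k. (n + 1 + i) * (n - i))"
    by (simp only: mult_ac)
  then show ?thesis by simp
qed

lemma choose_triple_factor_cong:
  assumes "p dvd (3 * n + 1) * (3 * n + 2)" "i \<le> n"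
  shows "[int (3 * (3 * i + 1) * (3 * i + 2)) = int ((n + 1 + i) * (n - i)) * (-27)] (mod int p)"
proof -
  obtain j where "n = i + j"
    using assms(2) le_Suc_ex by blast
  then have "int (3 * (3 * i + 1) * (3 * i + 2)) - int ((n + 1 + i) * (n - i)) * (-27) =
      3 * int ((3 * n + 1) * (3 * n + 2))"
    by (simp add: algebra_simps)
  moreover have "int p dvd \<dots>"
    using assms(1) by (intro dvd_mult) (simp only: int_dvd_int_iff)
  ultimately show ?thesis
    by (simp only: cong_iff_dvd_diff)
qed

lemma choose_triple_cong:
  assumes "prime p" "p dvd (3 * n + 1) * (3 * n + 2)" "k \<le> n" "2 * k < p"
  shows "[int ((3 * k) choose k) = int ((n + k) choose (2 * k)) * (-27) ^ k] (mod int p)"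
proof -
  have "fact (2 * k) * int ((3 * k) choose k) = (\<Prod>i<k. int (3 * (3 * i + 1) * (3 * i + 2)))"
    by (simp only: flip: of_nat_prod fact_mult_choose_triple) simp
  also have "[\<dots> = (\<Prod>i<k. int ((n + 1 + i) * (n - i)) * (-27))] (mod int p)"
    using assms(3) by (intro cong_prod choose_triple_factor_cong assms(2)) simp
  also have "(\<Prod>i<k. int ((n + 1 + i) * (n - i)) * (-27)) =
      (\<Prod>i<k. int ((n + 1 + i) * (n - i))) * (-27) ^ k"
    by (simp only: prod.distrib prod_constant card_lessThan)
  also have "(\<Prod>i<k. int ((n + 1 + i) * (n - i))) = fact (2 * k) * int ((n + k) choose (2 * k))"
    by (simp only: flip: of_nat_prod fact_mult_choose_add[OF assms(3)]) simp
  finally have "[fact (2 * k) * int ((3 * k) choose k) =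
      fact (2 * k) * (int ((n + k) choose (2 * k)) * (-27) ^ k)] (mod int p)"
    by (simp only: mult.assoc)
  moreover have "coprime p (fact (2 * k))"
    using assms(1,4) by (intro prime_imp_coprime) (simp_all add: prime_dvd_fact_iff)
  then have "coprime (fact (2 * k)) (int p)"
    by (metis coprime_commute coprime_int_iff of_nat_fact)
  ultimately show ?thesis
    using cong_mult_lcancel by blast
qed

lemma choose_triple_sum_cong:
  assumes "prime p" "3 < p"
  shows "[(\<Sum>k\<le>p div 3. int ((3 * k) choose k) * a ^ k) =
    morgan_voyce_b (-27 * a) (p div 3)] (mod int p)"
proof -
  define n where "n = p div 3"
  have "p = 3 * n + 1 \<or> p = 3 * n + 2"
    using prime_mod_three[OF assms] unfolding n_def by presburger
  then have "p dvd (3 * n + 1) * (3 * n + 2)"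
    by (elim disjE) (simp_all only: dvd_triv_left dvd_triv_right)
  then have "[(\<Sum>k\<le>n. int ((3 * k) choose k) * a ^ k) =
      (\<Sum>k\<le>n. int ((n + k) choose (2 * k)) * (-27) ^ k * a ^ k)] (mod int p)"
    using assms by (intro cong_sum cong_scalar_right choose_triple_cong) (auto simp: n_def)
  also have "(\<Sum>k\<le>n. int ((n + k) choose (2 * k)) * (-27) ^ k * a ^ k) = morgan_voyce_b (-27 * a) n"
    unfolding morgan_voyce_b_sum power_mult_distrib by (simp add: mult.assoc)
  finally show ?thesis
    unfolding n_def .
qed

lemma morgan_voyce_b_triple_cong_1:
  assumes p: "prime p" "3 < p" and nonresidue: "Legendre (a * (4 - 27 * a)) (int p) = -1"
  shows "[morgan_voyce_b (-27 * a) (3 * (p div 3) + 1) = 1] (mod int p)"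
proof -
  have "Legendre (-27 * a * (-27 * a + 4)) (int p) =
      Legendre (-3 * (3\<^sup>2 * (a * (4 - 27 * a)))) (int p)"
    by (simp add: algebra_simps)
  also have "\<dots> = - Legendre (-3) (int p)"
  proof -
    have "\<not> int p dvd 3"
      using p by (auto dest: zdvd_imp_le)
    then show ?thesis
      using p nonresidue Legendre_square[of "int p" 3] by (simp only: Legendre_mult) simp
  qed
  finally have character: "Legendre (-27 * a * (-27 * a + 4)) (int p) =
      (if p mod 3 = 1 then -1 else 1)"
    using p by (simp add: Legendre_minus_three)
  show ?thesis
  proof (cases "p mod 3 = 1")
    case True
    then have "3 * (p div 3) + 1 = p" by presburger
    with True show ?thesis
      using morgan_voyce_b_prime_cong_1[of p "-27 * a"] p character by simp
  next
    case False
    then have "3 * (p div 3) + 1 = p - 1"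
      using prime_mod_three[OF p] by presburger
    with False show ?thesis
      using morgan_voyce_b_pred_prime_cong_1[of p "-27 * a"] p character by simp
  qed
qed

lemma cubic_root_choose_triple_sum:
  fixes p :: nat and a :: int
  assumes p: "prime p" "3 < p" and nonresidue: "Legendre (a * (4 - 27 * a)) (int p) = -1"
  defines "s \<equiv> \<Sum>k\<le>p div 3. int ((3 * k) choose k) * a ^ k"
  shows "[(27 * a - 4) * s ^ 3 + 3 * s + 1 = 0] (mod int p)"
proof -
  define n where "n = p div 3"
  define b where "b = morgan_voyce_b (-27 * a)"
  have "[s = b n] (mod int p)"
    unfolding s_def b_def n_def by (rule choose_triple_sum_cong[OF p])
  then have "[(27 * a - 4) * s ^ 3 + 3 * s + 1 = (27 * a - 4) * b n ^ 3 + 3 * b n + 1] (mod int p)"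
    by (intro cong_add cong_scalar_left cong_pow cong_refl)
  also have "(27 * a - 4) * b n ^ 3 + 3 * b n + 1 = 1 - b (3 * n + 1)"
    unfolding b_def morgan_voyce_b_triple by (simp add: algebra_simps)
  also have "[\<dots> = 1 - 1] (mod int p)"
    using morgan_voyce_b_triple_cong_1[OF p nonresidue] unfolding b_def n_def
    by (intro cong_diff cong_refl)
  finally show ?thesis by simp
qed

section \<open>Congruences between rationals with denominator prime to \<open>p\<close>\<close>

lemma p_integersE:
  assumes "x \<in> p_integers p"
  obtains m d where "\<not> int p dvd d" "d \<noteq> 0" "x = of_int m / of_int d"
proof -
  obtain m d where "\<not> int p dvd d" "x = of_int m / of_int d"
    using assms unfolding p_integers_iff by blast
  then show thesis
    by (intro that[of d m]) auto
qed

lemma p_integersI: "\<not> int p dvd d \<Longrightarrow> of_int m / of_int d \<in> p_integers p"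
  unfolding p_integers_iff by blast

context
  fixes p :: nat
  assumes prime: "prime p"
begin

lemma p_integers_of_int: "of_int k \<in> p_integers p"
  using p_integersI[of p 1 k] prime_gt_1_nat[OF prime] by simp

lemma p_integers_add:
  assumes "x \<in> p_integers p" "y \<in> p_integers p"
  shows "x + y \<in> p_integers p"
proof -
  obtain m d where x: "\<not> int p dvd d" "d \<noteq> 0" "x = of_int m / of_int d"
    using assms(1) by (rule p_integersE)
  obtain n e where y: "\<not> int p dvd e" "e \<noteq> 0" "y = of_int n / of_int e"
    using assms(2) by (rule p_integersE)
  have "x + y = of_int (m * e + n * d) / of_int (d * e)"
    using x y by (simp add: field_simps)
  also have "\<dots> \<in> p_integers p"
    using x y prime by (intro p_integersI) (simp add: prime_dvd_mult_iff)
  finally show ?thesis .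
qed

lemma p_integers_mult:
  assumes "x \<in> p_integers p" "y \<in> p_integers p"
  shows "x * y \<in> p_integers p"
proof -
  obtain m d where x: "\<not> int p dvd d" "d \<noteq> 0" "x = of_int m / of_int d"
    using assms(1) by (rule p_integersE)
  obtain n e where y: "\<not> int p dvd e" "e \<noteq> 0" "y = of_int n / of_int e"
    using assms(2) by (rule p_integersE)
  have "x * y = of_int (m * n) / of_int (d * e)"
    using x y by simp
  also have "\<dots> \<in> p_integers p"
    using x y prime by (intro p_integersI) (simp add: prime_dvd_mult_iff)
  finally show ?thesis .
qed

lemma p_integers_uminus: "x \<in> p_integers p \<Longrightarrow> - x \<in> p_integers p"
  using p_integers_mult[OF p_integers_of_int[of "-1"]] by simp

lemma p_congI:
  assumes "y \<in> p_integers p" "t \<in> p_integers p" "x = y + of_nat p * t"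
  shows "p_cong p x y"
  using assms p_integers_of_int[of "int p"] unfolding p_cong_def
  by (auto intro: p_integers_add p_integers_mult)

lemma p_congE:
  assumes "p_cong p x y"
  obtains t where "x \<in> p_integers p" "y \<in> p_integers p" "t \<in> p_integers p" "x = y + of_nat p * t"
  using assms unfolding p_cong_def by (metis add.commute diff_add_cancel)

lemma p_cong_refl: "x \<in> p_integers p \<Longrightarrow> p_cong p x x"
  using p_integers_of_int[of 0] by (intro p_congI[of _ 0]) simp_all

lemma p_cong_sym:
  assumes "p_cong p x y"
  shows "p_cong p y x"
proof -
  obtain t where t: "x \<in> p_integers p" "t \<in> p_integers p" "x = y + of_nat p * t"
    using assms by (rule p_congE)
  then show ?thesis
    by (intro p_congI[of _ "- t"] p_integers_uminus) simp_all
qed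

lemma p_cong_trans:
  assumes "p_cong p x y" "p_cong p y z"
  shows "p_cong p x z"
proof -
  obtain t where t: "t \<in> p_integers p" "x = y + of_nat p * t"
    using assms(1) by (rule p_congE)
  obtain u where u: "u \<in> p_integers p" "z \<in> p_integers p" "y = z + of_nat p * u"
    using assms(2) by (rule p_congE)
  show ?thesis
    using t u by (intro p_congI[of _ "t + u"] p_integers_add) (simp_all add: algebra_simps)
qed

lemma p_cong_add:
  assumes "p_cong p x y" "p_cong p x' y'"
  shows "p_cong p (x + x') (y + y')"
proof -
  obtain t where t: "y \<in> p_integers p" "t \<in> p_integers p" "x = y + of_nat p * t"
    using assms(1) by (rule p_congE)
  obtain u where u: "y' \<in> p_integers p" "u \<in> p_integers p" "x' = y' + of_nat p * u"
    using assms(2) by (rule p_congE)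
  show ?thesis
    using t u by (intro p_congI[of _ "t + u"] p_integers_add) (simp_all add: algebra_simps)
qed

lemma p_cong_mult:
  assumes "p_cong p x y" "p_cong p x' y'"
  shows "p_cong p (x * x') (y * y')"
proof -
  obtain t where t: "y \<in> p_integers p" "t \<in> p_integers p" "x = y + of_nat p * t"
    using assms(1) by (rule p_congE)
  obtain u where u: "x' \<in> p_integers p" "y' \<in> p_integers p" "u \<in> p_integers p"
      "x' = y' + of_nat p * u"
    using assms(2) by (rule p_congE)
  have "x * x' = y * y' + of_nat p * (t * x' + y * u)"
    unfolding t(3) by (simp add: u(4) algebra_simps)
  with t u show ?thesis
    by (intro p_congI[of _ "t * x' + y * u"] p_integers_add p_integers_mult)
qed

lemma p_cong_of_int_refl: "p_cong p (of_int k) (of_int k)"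
  by (intro p_cong_refl p_integers_of_int)

lemma p_cong_diff:
  assumes "p_cong p x y" "p_cong p x' y'"
  shows "p_cong p (x - x') (y - y')"
  using p_cong_add[OF assms(1) p_cong_mult[OF p_cong_of_int_refl[of "-1"] assms(2)]] by simp

lemma p_cong_power: "p_cong p x y \<Longrightarrow> p_cong p (x ^ n) (y ^ n)"
  using p_cong_of_int_refl[of 1] by (induction n) (auto intro: p_cong_mult)

lemma p_cong_sum: "(\<And>i. i \<in> I \<Longrightarrow> p_cong p (f i) (g i)) \<Longrightarrow> p_cong p (sum f I) (sum g I)"
  using p_cong_of_int_refl[of 0]
  by (induction I rule: infinite_finite_induct) (auto intro: p_cong_add)

lemma p_cong_of_int_iff: "p_cong p (of_int m) (of_int n) \<longleftrightarrow> [m = n] (mod int p)"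
proof
  assume "p_cong p (of_int m) (of_int n)"
  then obtain t where t: "t \<in> p_integers p" "of_int m = of_int n + of_nat p * t"
    by (rule p_congE)
  obtain k e where e: "\<not> int p dvd e" "e \<noteq> 0" "t = of_int k / of_int e"
    using t(1) by (rule p_integersE)
  have "(of_int ((m - n) * e) :: rat) = of_int (int p * k)"
    using t(2) e by (simp add: field_simps)
  then have "(m - n) * e = int p * k"
    by (simp only: of_int_eq_iff)
  then have "int p dvd (m - n) * e"
    by simp
  then show "[m = n] (mod int p)"
    using e(1) prime by (simp add: prime_dvd_mult_iff cong_iff_dvd_diff)
next
  assume "[m = n] (mod int p)"
  then obtain k where "m = n + int p * k"
    by (metis cong_iff_lin cong_sym)
  then show "p_cong p (of_int m) (of_int n)"
    by (intro p_congI[of _ "of_int k"] p_integers_of_int) simp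
qed

lemma p_cong_p_residue: "r \<in> p_integers p \<Longrightarrow> p_cong p r (of_int (p_residue p r))"
  using theI'[OF p_residue_well_defined[OF prime]] unfolding p_residue_def by blast

lemma rat_Legendre_eq:
  assumes "p_cong p r (of_int m)"
  shows "rat_Legendre r p = Legendre m (int p)"
proof -
  have "p_cong p r (of_int (p_residue p r))"
    using assms by (intro p_cong_p_residue) (simp add: p_cong_def)
  then have "[p_residue p r = m] (mod int p)"
    using assms p_cong_sym p_cong_trans p_cong_of_int_iff by blast
  then show ?thesis
    unfolding rat_Legendre_def by (rule Legendre_cong)
qed

lemma p_cong_power_sum:
  assumes "p_cong p a (of_int \<alpha>)"
  shows "p_cong p (\<Sum>k\<in>K. of_nat (c k) * a ^ k) (of_int (\<Sum>k\<in>K. int (c k) * \<alpha> ^ k))"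
proof -
  have "p_cong p (\<Sum>k\<in>K. of_int (int (c k)) * a ^ k) (of_int (\<Sum>k\<in>K. int (c k) * \<alpha> ^ k))"
    unfolding of_int_sum of_int_mult of_int_power
    by (intro p_cong_sum p_cong_mult p_cong_power p_cong_of_int_refl assms)
  then show ?thesis by simp
qed

lemma rat_Legendre_cubic_discriminant:
  assumes "p_cong p a (of_int \<alpha>)"
  shows "rat_Legendre (a * (4 - 27 * a)) p = Legendre (\<alpha> * (4 - 27 * \<alpha>)) (int p)"
proof (rule rat_Legendre_eq)
  have "p_cong p (a * (of_int 4 - of_int 27 * a)) (of_int (\<alpha> * (4 - 27 * \<alpha>)))"
    unfolding of_int_mult of_int_diff
    by (intro p_cong_mult p_cong_diff p_cong_of_int_refl assms)
  then show "p_cong p (a * (4 - 27 * a)) (of_int (\<alpha> * (4 - 27 * \<alpha>)))"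
    by simp
qed

lemma p_cong_cubic_iff:
  assumes "p_cong p a (of_int \<alpha>)" "p_cong p x (of_int \<xi>)"
  shows "p_cong p ((27 * a - 4) * x ^ 3 + 3 * x + 1) 0 \<longleftrightarrow>
    [(27 * \<alpha> - 4) * \<xi> ^ 3 + 3 * \<xi> + 1 = 0] (mod int p)"
proof -
  have "p_cong p ((of_int 27 * a - of_int 4) * x ^ 3 + of_int 3 * x + of_int 1)
      (of_int ((27 * \<alpha> - 4) * \<xi> ^ 3 + 3 * \<xi> + 1))"
    unfolding of_int_add of_int_mult of_int_diff of_int_power
    by (intro p_cong_add p_cong_mult p_cong_diff p_cong_power p_cong_of_int_refl assms)
  then have "p_cong p ((27 * a - 4) * x ^ 3 + 3 * x + 1)
      (of_int ((27 * \<alpha> - 4) * \<xi> ^ 3 + 3 * \<xi> + 1))"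
    by simp
  then have "p_cong p ((27 * a - 4) * x ^ 3 + 3 * x + 1) 0 \<longleftrightarrow>
      p_cong p (of_int ((27 * \<alpha> - 4) * \<xi> ^ 3 + 3 * \<xi> + 1)) (of_int 0)"
    unfolding of_int_0 using p_cong_trans p_cong_sym by blast
  then show ?thesis
    unfolding p_cong_of_int_iff .
qed

end

theorem theorem3p10:
  fixes p :: nat and a S :: rat
  assumes "prime p" and "p > 3"
    and "a \<in> p_integers p"
    and "rat_Legendre (a * (4 - 27 * a)) p = -1"
  defines "S \<equiv> (\<Sum>k = 0..p div 3. of_nat ((3 * k) choose k) * a ^ k)"
  shows "p_cong p ((27 * a - 4) * S ^ 3 + 3 * S + 1) 0 \<and>
    (\<forall>x \<in> p_integers p.
       p_cong p ((27 * a - 4) * x ^ 3 + 3 * x + 1) 0 \<longrightarrow> p_cong p x S)"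
proof (intro conjI ballI impI)
  define \<alpha> where "\<alpha> = p_residue p a"
  define \<sigma> where "\<sigma> = (\<Sum>k\<le>p div 3. int ((3 * k) choose k) * \<alpha> ^ k)"
  have a: "p_cong p a (of_int \<alpha>)"
    unfolding \<alpha>_def using assms(1,3) by (rule p_cong_p_residue)
  have S: "p_cong p S (of_int \<sigma>)"
    unfolding S_def \<sigma>_def atLeast0AtMost by (rule p_cong_power_sum[OF assms(1) a])
  have nonresidue: "Legendre (\<alpha> * (4 - 27 * \<alpha>)) (int p) = -1"
    using rat_Legendre_cubic_discriminant[OF assms(1) a] assms(4) by simp
  have root: "[(27 * \<alpha> - 4) * \<sigma> ^ 3 + 3 * \<sigma> + 1 = 0] (mod int p)"
    unfolding \<sigma>_def by (rule cubic_root_choose_triple_sum[OF assms(1,2) nonresidue])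
  then show "p_cong p ((27 * a - 4) * S ^ 3 + 3 * S + 1) 0"
    using p_cong_cubic_iff[OF assms(1) a S] by blast
  fix x
  assume "x \<in> p_integers p" and x_root: "p_cong p ((27 * a - 4) * x ^ 3 + 3 * x + 1) 0"
  then have x: "p_cong p x (of_int (p_residue p x))"
    by (intro p_cong_p_residue assms(1))
  then have "[p_residue p x = \<sigma>] (mod int p)"
    using cubic_root_unique[OF assms(1,2) nonresidue _ root] p_cong_cubic_iff[OF assms(1) a x] x_root
    by blast
  then show "p_cong p x S"
    using x S p_cong_of_int_iff p_cong_trans p_cong_sym assms(1) by meson
qed

end
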